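(* Let $d\ge 1$ and let $A\in\mathrm{GL}_d(\mathbb{R})$ with $\|A\|<1$. Then for Lebesgue almost every $b\in\mathbb{R}^d$, the map $f\colon[0,1)^d\to[0,1)^d$ defined by $f(x)=Ax+b\pmod{\mathbb{Z}^d}$ is asymptotically periodic.
   Context: For $x=(x_j)\in\mathbb{R}^d$, $\|x\|=\max_{1\le j\le d}|x_j|$, and $\|A\|=\sup_{x\ne0}\|Ax\|/\|x\|$ is the induced operator norm. Explicitly, $f(x)=Ax+b-\lfloor Ax+b\rfloor$, where $\lfloor\cdot\rfloor$ is the component-wise floor function. For $x\in[0,1)^d$ the $\omega$-limit set is $\omega(f,x)=\bigcap_{m\ge1}\overline{\bigcup_{n\ge m}\{f^n(x)\}}$, where the bar denotes closure in $\mathbb{R}^d$, and $\omega(f)=\bigcup_{x\in[0,1)^d}\omega(f,x)$. The map $f$ is called asymptotically periodic if $\omega(f)$ is the union of finitely many periodic orbits of $f$. *)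

theory Defs
  imports "HOL-Analysis.Analysis"
begin

text \<open>
  The library's \<open>onorm\<close> is induced by the Euclidean norm; here the operator norm
  is induced by the maximum norm, which is \<open>infnorm\<close> (see \<open>infnorm_cart\<close>).
\<close>

definition max_onorm :: "real^'n^'n \<Rightarrow> real"
  where "max_onorm A = (SUP x\<in>{x. x \<noteq> 0}. infnorm (A *v x) / infnorm x)"

definition unit_cube :: "(real^'n) set"
  where "unit_cube = {x. \<forall>i. 0 \<le> x $ i \<and> x $ i < 1}"

definition floor_vec :: "real^'n \<Rightarrow> real^'n"
  where "floor_vec x = (\<chi> i. of_int \<lfloor>x $ i\<rfloor>)"

text \<open>
  The map is a total function on \<open>real^'n\<close> with values in \<open>unit_cube\<close>;
  the dynamical notions below take the phase space \<open>X\<close> as an explicit argument.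
\<close>

definition affine_mod1 :: "real^'n^'n \<Rightarrow> real^'n \<Rightarrow> real^'n \<Rightarrow> real^'n"
  where "affine_mod1 A b x = A *v x + b - floor_vec (A *v x + b)"

definition omega_limit :: "('a::topological_space \<Rightarrow> 'a) \<Rightarrow> 'a \<Rightarrow> 'a set"
  where "omega_limit f x = (\<Inter>m\<in>{1..}. closure (\<Union>n\<in>{m..}. {(f ^^ n) x}))"

definition omega_limit_set :: "'a::topological_space set \<Rightarrow> ('a \<Rightarrow> 'a) \<Rightarrow> 'a set"
  where "omega_limit_set X f = (\<Union>x\<in>X. omega_limit f x)"

definition periodic_orbit :: "'a set \<Rightarrow> ('a \<Rightarrow> 'a) \<Rightarrow> 'a set \<Rightarrow> bool"
  where "periodic_orbit X f C \<longleftrightarrow>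
    (\<exists>x\<in>X. \<exists>p\<ge>1. (f ^^ p) x = x \<and> C = range (\<lambda>n. (f ^^ n) x))"

definition asymptotically_periodic :: "'a::topological_space set \<Rightarrow> ('a \<Rightarrow> 'a) \<Rightarrow> bool"
  where "asymptotically_periodic X f \<longleftrightarrow>
    (\<exists>\<C>. finite \<C> \<and> (\<forall>C\<in>\<C>. periodic_orbit X f C) \<and> omega_limit_set X f = \<Union>\<C>)"

end

theory Submission
  imports Defs
begin

text \<open>
  Put \<open>c = (I - A)\<^sup>-\<^sup>1 b\<close>, so that translation by \<open>- c\<close> turns \<open>f\<close> into
  \<open>g c z = A z - \<lfloor>A z + c\<rfloor>\<close>. If after some number \<open>n\<close> of steps all orbits stay at
  positive distance from the discontinuities, then \<open>f\<close> is a contraction on nearby points of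
  \<open>f\<^sup>n [0,1)\<^sup>d\<close>, and every limit set is one of finitely many periodic orbits.

  All \<open>n\<close>-step orbits end within \<open>O(l\<^sup>n)\<close> of a finite set of points that depend
  only on the itinerary, where \<open>\<parallel>A\<parallel> \<le> l < 1\<close>. If the above fails for \<open>c\<close>, then for every \<open>n\<close>
  some coordinate of \<open>c\<close> is \<open>O(l\<^sup>n)\<close>-close to one of finitely many numbers given by these points.
  The number of points grows more slowly than \<open>l\<^sup>-\<^sup>n\<close>, even with \<open>c\<close> ranging over a
  small ball: locally, \<open>N\<close> steps are determined by the signs of \<open>N d\<close> linear functionals
  on a space of dimension \<open>2 d\<close>, hence branch in at most \<open>(N d + 1)^(2 d)\<close> ways.
  Therefore the exceptional \<open>c\<close> form a null set.
\<close>

subsection \<open>Sign patterns of linear functionals\<close>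

text \<open>
  Adding one functional \<open>l j\<close> to the arrangement splits exactly those patterns that are realised on
  both sides of its kernel, and by convexity these are realised on the kernel, which has smaller
  dimension.
\<close>

lemma card_sign_patterns:
  fixes l :: "'i \<Rightarrow> 'a::euclidean_space \<Rightarrow> real"
  assumes "finite I" and "\<And>i. i \<in> I \<Longrightarrow> linear (l i)" and "subspace V"
  shows "card ((\<lambda>h. {i\<in>I. 0 \<le> l i h}) ` V) \<le> (card I + 1) ^ dim V"
  using assms
proof (induction I arbitrary: V rule: finite_induct)
  case empty
  then show ?case
    using card_image_le[of "{{}}" id] by (simp add: image_constant_conv)
next
  case (insert j I)
  define pat where "pat I V = (\<lambda>h. {i\<in>I. 0 \<le> l i h}) ` V" for I V
  define S where "S = pat (insert j I) V"
  define S0 where "S0 = {X\<in>S. j \<notin> X}"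
  define S1 where "S1 = {X\<in>S. j \<in> X}"
  \<comment> \<open>\<open>S0\<close> and \<open>B1\<close> both consist of patterns for
    \<open>I\<close>; their intersection collects those that occur on both sides of the kernel of
    \<open>l j\<close>.\<close>
  define B1 where "B1 = (\<lambda>X. X - {j}) ` S1"
  define K where "K = {h\<in>V. l j h = 0}"
  have linj: "linear (l j)" using insert by simp
  have pat_Pow: "pat I V \<subseteq> Pow I" for I V
    by (auto simp: pat_def)
  have fin: "finite (pat I V)" if "finite I" for I V
    using finite_subset[OF pat_Pow] that by blast
  have finS: "finite S" using fin insert.hyps(1) by (simp add: S_def)
  have "inj_on (\<lambda>X. X - {j}) S1"
    by (auto simp: inj_on_def S1_def)
  then have cB1: "card B1 = card S1"
    by (simp add: B1_def card_image)
  have "S = S0 \<union> S1" "S0 \<inter> S1 = {}" by (auto simp: S0_def S1_def)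
  then have "card S = card S0 + card B1"
    using cB1 finS by (metis card_Un_disjoint finite_Un)
  also have "\<dots> = card (S0 \<union> B1) + card (S0 \<inter> B1)"
    using finS by (intro card_Un_Int) (auto simp: S0_def B1_def S1_def)
  finally have cS: "card S = card (S0 \<union> B1) + card (S0 \<inter> B1)" .
  have S0E: "\<exists>h\<in>V. l j h < 0 \<and> X = {i\<in>I. 0 \<le> l i h}" if "X \<in> S0" for X
    using that unfolding S0_def S_def pat_def by force
  have B1E: "\<exists>h\<in>V. 0 \<le> l j h \<and> X = {i\<in>I. 0 \<le> l i h}" if "X \<in> B1" for X
    using that insert.hyps(2) unfolding B1_def S1_def S_def pat_def by force
  have "S0 \<union> B1 \<subseteq> pat I V"
    using S0E B1E unfolding pat_def by blast
  then have "card (S0 \<union> B1) \<le> card (pat I V)"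
    using fin insert.hyps(1) by (simp add: card_mono)
  also have "\<dots> \<le> (card I + 1) ^ dim V"
    using insert unfolding pat_def by simp
  finally have c1: "card (S0 \<union> B1) \<le> (card I + 1) ^ dim V" .
  have subK: "subspace K"
    using linj insert.prems(2)
    by (auto simp: K_def subspace_def linear_0 linear_add linear_cmul)
  have sub: "S0 \<inter> B1 \<subseteq> pat I K"
  proof
    fix X assume "X \<in> S0 \<inter> B1"
    then obtain u v where u: "u \<in> V" "l j u < 0" "X = {i\<in>I. 0 \<le> l i u}"
      and v: "v \<in> V" "0 \<le> l j v" "X = {i\<in>I. 0 \<le> l i v}"
      using S0E[of X] B1E[of X] by blast
    \<comment> \<open>A positive multiple of the point where the segment from \<open>u\<close> to
      \<open>v\<close> meets the kernel of \<open>l j\<close>. The weight of \<open>v\<close> is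
      strictly positive, so common negative signs stay strict.\<close>
    define w where "w = l j v *\<^sub>R u + (- l j u) *\<^sub>R v"
    have "w \<in> V"
      using u v insert.prems(2) unfolding w_def by (intro subspace_add subspace_scale) auto
    moreover have lw: "l i w = l j v * l i u + (- l j u) * l i v" if "linear (l i)" for i
      using that unfolding w_def by (simp only: linear_add linear_cmul real_scaleR_def)
    moreover have "l j w = 0"
      using lw[OF linj] by simp
    moreover have "0 \<le> l i w \<longleftrightarrow> i \<in> X" if "i \<in> I" for i
    proof -
      have lin: "linear (l i)" using that insert.prems by simp
      show ?thesis
      proof (cases "i \<in> X")
        case True
        then have "0 \<le> l i u" "0 \<le> l i v" using u v by auto
        then have "0 \<le> l i w" unfolding lw[OF lin] using u(2) v(2)
          by (intro add_nonneg_nonneg mult_nonneg_nonneg) auto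
        then show ?thesis using True by simp
      next
        case False
        then have "l i u < 0" "l i v < 0" using u(3) v(3) that by force+
        then have "l j v * l i u \<le> 0" "(- l j u) * l i v < 0"
          using u(2) v(2) by (auto simp: mult_nonneg_nonpos mult_neg_neg)
        then show ?thesis using False lw[OF lin] by auto
      qed
    qed
    moreover have "X \<subseteq> I" using u by auto
    ultimately show "X \<in> pat I K"
      unfolding pat_def K_def by (intro image_eqI[of _ _ w]) auto
  qed
  \<comment> \<open>In dimension 0 no linear functional takes a negative value and \<open>S0\<close>
    is empty; otherwise the kernel loses at least one dimension.\<close>
  have c2: "card (S0 \<inter> B1) \<le> (if dim V = 0 then 0 else (card I + 1) ^ (dim V - 1))"
  proof (cases "S0 = {}")
    case False
    then obtain u where u: "u \<in> V" "l j u < 0" using S0E by blast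
    then have "K \<subset> V" unfolding K_def by force
    then have "span K \<subset> span V"
      using subK insert.prems(2) by (simp add: span_eq_iff[THEN iffD2])
    then have d: "dim K < dim V" by (rule dim_psubset)
    have "card (S0 \<inter> B1) \<le> card (pat I K)"
      using fin insert.hyps(1) sub by (simp add: card_mono)
    also have "\<dots> \<le> (card I + 1) ^ dim K"
      using insert subK unfolding pat_def by simp
    also have "\<dots> \<le> (card I + 1) ^ (dim V - 1)"
      using d by (intro power_increasing) auto
    finally have "card (S0 \<inter> B1) \<le> (card I + 1) ^ (dim V - 1)" .
    moreover have "dim V \<noteq> 0" using d by linarith
    ultimately show ?thesis by presburger
  qed simp
  have "card S \<le> (card (insert j I) + 1) ^ dim V"
  proof (cases "dim V")
    case 0
    show ?thesis using c1 c2 cS unfolding 0 by simp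
  next
    case (Suc D)
    have "card S \<le> (card I + 1) ^ Suc D + (card I + 1) ^ D"
      using c1 c2 cS unfolding Suc by simp
    also have "\<dots> = (card I + 2) * (card I + 1) ^ D" by simp
    also have "\<dots> \<le> (card I + 2) * (card I + 2) ^ D"
      by (intro mult_left_mono power_mono) auto
    finally show ?thesis unfolding Suc using insert.hyps by simp
  qed
  then show ?case unfolding S_def pat_def .
qed

subsection \<open>Local contractions\<close>

lemma tendsto_infnorm_diff_iff:
  fixes g :: "'b \<Rightarrow> 'a::euclidean_space"
  shows "(g \<longlongrightarrow> a) F \<longleftrightarrow> ((\<lambda>k. infnorm (g k - a)) \<longlongrightarrow> 0) F"
proof
  assume "(g \<longlongrightarrow> a) F"
  then have "((\<lambda>k. infnorm (g k - a)) \<longlongrightarrow> infnorm (a - a)) F"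
    by (intro tendsto_intros)
  then show "((\<lambda>k. infnorm (g k - a)) \<longlongrightarrow> 0) F" by (simp add: infnorm_0)
next
  assume *: "((\<lambda>k. infnorm (g k - a)) \<longlongrightarrow> 0) F"
  have "((\<lambda>k. sqrt DIM('a) * infnorm (g k - a)) \<longlongrightarrow> sqrt DIM('a) * 0) F"
    by (intro tendsto_intros *)
  then have "((\<lambda>k. sqrt DIM('a) * infnorm (g k - a)) \<longlongrightarrow> 0) F" by simp
  then have "((\<lambda>k. g k - a) \<longlongrightarrow> 0) F"
    by (rule Lim_null_comparison[rotated]) (simp add: norm_le_infnorm)
  then show "(g \<longlongrightarrow> a) F"
    using Lim_null by blast
qed

lemma tendsto_infnorm_comparison:
  fixes g :: "nat \<Rightarrow> 'a::euclidean_space"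
  assumes "\<And>k. infnorm (g k - a) \<le> h k" "h \<longlonglongrightarrow> 0"
  shows "g \<longlonglongrightarrow> a"
proof (rule tendsto_infnorm_diff_iff[THEN iffD2])
  show "(\<lambda>k. infnorm (g k - a)) \<longlonglongrightarrow> 0"
    by (rule Lim_null_comparison[OF _ assms(2)]) (simp add: assms(1) real_abs_infnorm)
qed

text \<open>\<open>f\<close> may be discontinuous. \<open>E\<close> stands for the points kept away
  from the discontinuities; its closedness lets limits of orbits inherit the contraction
  estimate.\<close>

locale local_contraction =
  fixes f :: "'a::euclidean_space \<Rightarrow> 'a" and X E :: "'a set" and l \<eta> :: real and n :: nat
  assumes l: "0 \<le> l" "l < 1" and \<eta>: "0 < \<eta>"
    and bounded: "bounded X" and into: "f x \<in> X"
    and closed: "closed E" and iter_in: "x \<in> X \<Longrightarrow> (f ^^ n) x \<in> E"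
    and contr: "\<lbrakk>x \<in> E; y \<in> E; infnorm (x - y) < \<eta>\<rbrakk> \<Longrightarrow> infnorm (f x - f y) \<le> l * infnorm (x - y)"
begin

lemma iter_into: "x \<in> X \<Longrightarrow> (f ^^ k) x \<in> X"
  by (cases k) (auto simp: into)

lemma iter_in_add: "x \<in> X \<Longrightarrow> (f ^^ (n + k)) x \<in> E"
  by (simp add: funpow_add iter_in iter_into)

lemma infnorm_iter_le:
  assumes "\<And>k. (f ^^ k) x \<in> E" "\<And>k. (f ^^ k) y \<in> E" "infnorm (x - y) < \<eta>"
  shows "infnorm ((f ^^ j) x - (f ^^ j) y) \<le> l ^ j * infnorm (x - y)"
proof (induction j)
  case (Suc j)
  have "l ^ j * infnorm (x - y) \<le> 1 * infnorm (x - y)"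
    using l by (intro mult_right_mono power_le_one infnorm_pos_le) auto
  then have "infnorm ((f ^^ j) x - (f ^^ j) y) < \<eta>"
    using Suc assms(3) by linarith
  then have "infnorm (f ((f ^^ j) x) - f ((f ^^ j) y)) \<le> l * infnorm ((f ^^ j) x - (f ^^ j) y)"
    using assms by (intro contr)
  also have "\<dots> \<le> l * (l ^ j * infnorm (x - y))"
    using Suc l by (intro mult_left_mono)
  finally show ?case by simp
qed simp

lemma iter_tendsto:
  assumes lim: "a \<longlonglongrightarrow> c" and inE: "\<And>k j. (f ^^ j) (a k) \<in> E"
  shows "(\<lambda>k. (f ^^ j) (a k)) \<longlonglongrightarrow> (f ^^ j) c" "(f ^^ j) c \<in> E"
proof -
  have "(\<lambda>k. (f ^^ j) (a k)) \<longlonglongrightarrow> (f ^^ j) c \<and> (f ^^ j) c \<in> E"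
  proof (induction j)
    case 0
    show ?case using lim closed_sequentially[OF closed _ lim] inE[of 0] by simp
  next
    case (Suc j)
    let ?d = "\<lambda>k. infnorm ((f ^^ j) (a k) - (f ^^ j) c)"
    have d: "?d \<longlonglongrightarrow> 0"
      using Suc tendsto_infnorm_diff_iff[THEN iffD1] by blast
    then have "eventually (\<lambda>k. ?d k < \<eta>) sequentially"
      using \<eta> order_tendstoD(2) by blast
    then have ev: "eventually (\<lambda>k. norm (infnorm ((f ^^ Suc j) (a k) - (f ^^ Suc j) c)) \<le> l * ?d k) sequentially"
      by eventually_elim (use Suc inE contr in \<open>simp add: real_abs_infnorm\<close>)
    have "(\<lambda>k. l * ?d k) \<longlonglongrightarrow> 0"
      using tendsto_mult_left[OF d, of l] by simp
    from Lim_null_comparison[OF ev this]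
    have lim': "(\<lambda>k. (f ^^ Suc j) (a k)) \<longlonglongrightarrow> (f ^^ Suc j) c"
      by (rule tendsto_infnorm_diff_iff[THEN iffD2])
    then show ?case using closed_sequentially[OF closed _ lim'] inE by blast
  qed
  then show "(\<lambda>k. (f ^^ j) (a k)) \<longlonglongrightarrow> (f ^^ j) c" "(f ^^ j) c \<in> E" by auto
qed

section \<open>Periodic points and limit sets\<close>

definition periodic_points :: "'a set"
  where "periodic_points = {y\<in>X. \<exists>p\<ge>1. (f ^^ p) y = y}"

lemma periodic_iter: "(f ^^ p) y = y \<Longrightarrow> (f ^^ (k * p)) y = y"
  using funpow_mod_eq[of p f y "k * p"] by simp

text \<open>Going round the cycle \<open>n\<close> more times returns to the same point and raises
  the time index to at least \<open>n\<close>.\<close>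

lemma periodic_iter_in:
  assumes "y \<in> periodic_points"
  shows "(f ^^ j) y \<in> E"
proof -
  obtain p where p: "p \<ge> 1" "(f ^^ p) y = y" and y: "y \<in> X"
    using assms by (auto simp: periodic_points_def)
  obtain k where k: "j + n * p = n + k"
    using p(1) by (metis add.left_commute le_add_diff_inverse mult.commute mult_le_mono1 nat_mult_1)
  have "(f ^^ j) y = (f ^^ (j + n * p)) y"
    using periodic_iter[OF p(2)] by (simp add: funpow_add)
  then show ?thesis using iter_in_add[OF y] k by simp
qed

text \<open>After the common period \<open>p * q\<close> both points are back, yet their distance
  has shrunk by a factor below 1.\<close>

lemma periodic_points_separated:
  assumes "x \<in> periodic_points" "y \<in> periodic_points" "infnorm (x - y) < \<eta>"
  shows "x = y"
proof -
  obtain p q where p: "p \<ge> 1" "(f ^^ p) x = x" and q: "q \<ge> 1" "(f ^^ q) y = y"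
    using assms by (auto simp: periodic_points_def)
  have "infnorm (x - y) \<le> l ^ (p * q) * infnorm (x - y)"
    using infnorm_iter_le[of x y "p * q"] assms periodic_iter_in
      periodic_iter[OF p(2), of q] periodic_iter[OF q(2), of p]
    by (simp add: mult.commute)
  moreover have "l ^ (p * q) < 1"
    using l p q by (intro power_less_one_iff[THEN iffD2]) auto
  ultimately have "infnorm (x - y) = 0"
    using infnorm_pos_le[of "x - y"] mult_less_cancel_right2 by fastforce
  then show ?thesis by (simp add: infnorm_eq_0)
qed

lemma finite_periodic_points: "finite periodic_points"
proof -
  have "\<forall>x\<in>periodic_points. \<forall>y\<in>periodic_points. dist x y < \<eta> \<longrightarrow> x = y"
    using periodic_points_separated infnorm_le_norm by (metis dist_norm order_le_less_trans)
  then have "uniform_discrete periodic_points"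
    using \<eta> unfolding uniform_discrete_def by blast
  moreover have "bounded periodic_points"
    using bounded by (rule bounded_subset) (auto simp: periodic_points_def)
  ultimately show ?thesis
    using uniform_discrete_finite_iff by blast
qed

text \<open>The orbit of \<open>x\<close> is shadowed by that of a subsequential limit
  \<open>v\<close>. Shadowing makes \<open>v\<close> recurrent, and contraction turns recurrence
  into periodicity.\<close>

lemma omega_limit_periodic_orbit:
  assumes x: "x \<in> X"
  shows "periodic_orbit X f (omega_limit f x)" "omega_limit f x \<subseteq> periodic_points"
proof -
  define s where "s k = (f ^^ (n + k)) x" for k
  have sE: "s k \<in> E" for k by (simp add: s_def iter_in_add x)
  have fs: "(f ^^ j) (s k) = s (k + j)" for j k
    unfolding s_def by (metis add.assoc add.commute comp_apply funpow_add)
  have "range s \<subseteq> X" using x iter_into by (auto simp: s_def)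
  then have "bounded (range s)" using bounded bounded_subset by blast
  then obtain v r where r: "strict_mono (r :: nat \<Rightarrow> nat)" and v: "(s \<circ> r) \<longlonglongrightarrow> v"
    using bounded_imp_convergent_subsequence by blast
  have lim: "(\<lambda>k. s (r k + j)) \<longlonglongrightarrow> (f ^^ j) v" and vE: "(f ^^ j) v \<in> E" for j
    using iter_tendsto[OF v, of j] by (simp_all add: fs sE)
  have "(\<lambda>k. infnorm (s (r k) - v)) \<longlonglongrightarrow> 0"
    using tendsto_infnorm_diff_iff[THEN iffD1, OF v] by (simp add: comp_def)
  then have "eventually (\<lambda>k. infnorm (s (r k) - v) < \<eta>) sequentially"
    using \<eta> by (rule order_tendstoD)
  then obtain k0 where k0: "infnorm (s (r k0) - v) < \<eta>"
    by (auto simp: eventually_sequentially)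
  define m where "m = r k0"
  define e where "e j = s (m + j) - (f ^^ j) v" for j
  have e: "e \<longlonglongrightarrow> 0"
  proof -
    have "infnorm (e j - 0) \<le> l ^ j * infnorm (s m - v)" for j
      using infnorm_iter_le[of "s m" v j] fs sE vE k0
      by (simp add: e_def m_def)
    moreover have "(\<lambda>j. l ^ j * infnorm (s m - v)) \<longlonglongrightarrow> 0"
      using tendsto_mult_right[OF LIMSEQ_power_zero[of l]] l by simp
    ultimately show ?thesis
      by (rule tendsto_infnorm_comparison)
  qed
  define i where "i k = r (k + k0) - m" for k
  have ri: "r (k + k0) = m + i k" for k
    using strict_mono_mono[OF r] by (simp add: i_def m_def mono_def)
  have mono_i: "strict_mono i"
    unfolding strict_mono_def
  proof (intro allI impI)
    fix a b :: nat assume "a < b"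
    then have "r (a + k0) < r (b + k0)" using r by (simp add: strict_mono_def)
    then show "i a < i b" using ri[of a] ri[of b] by linarith
  qed
  have "(\<lambda>k. s (m + i k)) \<longlonglongrightarrow> v"
    using LIMSEQ_ignore_initial_segment[OF v, of k0] by (simp add: ri)
  moreover have "(\<lambda>k. e (i k)) \<longlonglongrightarrow> 0"
    using LIMSEQ_subseq_LIMSEQ[OF e mono_i] by (simp add: comp_def)
  ultimately have "(\<lambda>k. s (m + i k) - e (i k)) \<longlonglongrightarrow> v - 0"
    by (rule tendsto_diff)
  \<comment> \<open>The error \<open>e\<close> vanishes along \<open>i\<close>, so the returns of
    the orbit of \<open>x\<close> to \<open>v\<close> become returns of the orbit of
    \<open>v\<close> to itself.\<close>
  then have rec: "(\<lambda>k. (f ^^ i k) v) \<longlonglongrightarrow> v"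
    by (simp add: e_def)
  then have "(\<lambda>k. infnorm ((f ^^ i k) v - v)) \<longlonglongrightarrow> 0"
    by (rule tendsto_infnorm_diff_iff[THEN iffD1])
  then have "eventually (\<lambda>k. infnorm ((f ^^ i k) v - v) < \<eta> \<and> 1 \<le> k) sequentially"
    using \<eta> by (intro eventually_conj eventually_ge_at_top order_tendstoD)
  then obtain k1 where k1: "infnorm ((f ^^ i k1) v - v) < \<eta>" "1 \<le> k1"
    by (auto simp: eventually_sequentially)
  define q where "q = i k1"
  have q1: "1 \<le> q"
    using k1(2) seq_suble[OF mono_i, of k1] unfolding q_def by linarith
  have comm: "(f ^^ a) ((f ^^ b) v) = (f ^^ (a + b)) v" for a b
    by (simp add: funpow_add)
  \<comment> \<open>The orbits of \<open>(f ^^ q) v\<close> and \<open>v\<close> start less than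
    \<open>\<eta>\<close> apart and hence approach each other; along the times \<open>i\<close> they
    also tend to their starting points, which must coincide.\<close>
  have qv: "(f ^^ q) v = v"
  proof -
    let ?g = "\<lambda>k. (f ^^ q) ((f ^^ i k) v) - (f ^^ i k) v"
    have "?g \<longlonglongrightarrow> (f ^^ q) v - v"
      using iter_tendsto(1)[OF rec, of q] rec vE by (intro tendsto_diff) (simp_all add: comm)
    moreover have "?g \<longlonglongrightarrow> 0"
    proof -
      have "infnorm (?g k - 0) \<le> l ^ i k * infnorm ((f ^^ q) v - v)" for k
        using infnorm_iter_le[of "(f ^^ q) v" v "i k"] vE k1(1)
        by (simp add: comm q_def add.commute)
      moreover have "(\<lambda>k. l ^ i k * infnorm ((f ^^ q) v - v)) \<longlonglongrightarrow> 0"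
        using tendsto_mult_right[OF LIMSEQ_subseq_LIMSEQ[OF LIMSEQ_power_zero[of l] mono_i]] l
        by (simp add: comp_def)
      ultimately show ?thesis
        by (rule tendsto_infnorm_comparison)
    qed
    ultimately show ?thesis using LIMSEQ_unique by fastforce
  qed
  \<comment> \<open>\<open>X\<close> need not be closed, so membership of the limit is read off
    periodicity: \<open>v\<close> is a value of \<open>f\<close>.\<close>
  have vX: "v \<in> X"
    using into[of "(f ^^ (q - 1)) v"] q1 qv by (metis Suc_diff_1 funpow.simps(2) comp_apply less_le_trans zero_less_one)
  define C where "C = range (\<lambda>j. (f ^^ j) v)"
  have "C \<subseteq> periodic_points"
  proof
    fix y assume "y \<in> C"
    then obtain j where y: "y = (f ^^ j) v" by (auto simp: C_def)
    have "(f ^^ q) y = y" unfolding y using qv by (metis comm add.commute)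
    then show "y \<in> periodic_points"
      using q1 iter_into[OF vX] by (auto simp: periodic_points_def y)
  qed
  then have "finite C" using finite_periodic_points finite_subset by blast
  then have clC: "closed C" by (rule finite_imp_closed)
  have "omega_limit f x = C"
  proof
    show "C \<subseteq> omega_limit f x"
    proof
      fix y assume "y \<in> C"
      then obtain j where y: "y = (f ^^ j) v" by (auto simp: C_def)
      have "y \<in> closure (\<Union>n\<in>{M..}. {(f ^^ n) x})" for M
      proof -
        have "eventually (\<lambda>k. s (r k + j) \<in> closure (\<Union>n\<in>{M..}. {(f ^^ n) x})) sequentially"
          using eventually_ge_at_top[of M]
        proof eventually_elim
          case (elim k)
          then have "M \<le> n + (r k + j)" using seq_suble[OF r, of k] by linarith
          then show ?case using closure_subset by (fastforce simp: s_def)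
        qed
        then show ?thesis
          unfolding y by (intro Lim_in_closed_set[OF closed_closure _ _ lim]) auto
      qed
      then show "y \<in> omega_limit f x" by (simp add: omega_limit_def)
    qed
    show "omega_limit f x \<subseteq> C"
    proof
      fix y assume y: "y \<in> omega_limit f x"
      have "\<exists>w\<in>C. dist w y < \<epsilon>" if "\<epsilon> > 0" for \<epsilon>
      proof -
        have "eventually (\<lambda>j. dist (e j) 0 < \<epsilon> / 2) sequentially"
          using e that by (intro tendstoD) auto
        then obtain J where J: "norm (e j) < \<epsilon> / 2" if "j \<ge> J" for j
          by (auto simp: eventually_sequentially)
        \<comment> \<open>The \<open>+1\<close> puts the index into the range \<open>{1..}\<close>
          of the intersection; the rest leaves at least \<open>J\<close> steps after time
          \<open>n + m\<close>.\<close>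
        have "y \<in> closure (\<Union>n\<in>{n+m+J+1..}. {(f ^^ n) x})"
          using y unfolding omega_limit_def by (rule INT_D) simp
        then have "\<exists>w\<in>(\<Union>n\<in>{n+m+J+1..}. {(f ^^ n) x}). dist w y < \<epsilon> / 2"
          using half_gt_zero[OF that] unfolding closure_approachable by blast
        then obtain k where k: "k \<ge> n+m+J+1" "dist ((f ^^ k) x) y < \<epsilon> / 2"
          by blast
        define j where "j = k - n - m"
        have kj: "k = n + (m + j)" "j \<ge> J" using k(1) by (auto simp: j_def)
        have "dist ((f ^^ j) v) y \<le> norm (e j) + dist ((f ^^ k) x) y"
          unfolding e_def s_def kj(1)[symmetric]
          by (metis dist_norm dist_commute dist_triangle)
        then have "dist ((f ^^ j) v) y < \<epsilon>" using J[OF kj(2)] k(2) by linarith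
        then show ?thesis unfolding C_def by blast
      qed
      then have "y \<in> closure C" by (simp add: closure_approachable)
      then show "y \<in> C" using clC by simp
    qed
  qed
  then show "periodic_orbit X f (omega_limit f x)" "omega_limit f x \<subseteq> periodic_points"
    using \<open>C \<subseteq> periodic_points\<close> vX q1 qv unfolding periodic_orbit_def C_def by auto
qed

theorem asymptotically_periodic: "asymptotically_periodic X f"
proof -
  have "omega_limit f ` X \<subseteq> Pow periodic_points"
    using omega_limit_periodic_orbit(2) by blast
  then have "finite (omega_limit f ` X)"
    using finite_periodic_points finite_subset by blast
  then show ?thesis
    using omega_limit_periodic_orbit(1)
    unfolding asymptotically_periodic_def omega_limit_set_def
    by (intro exI[of _ "omega_limit f ` X"]) auto
qed

end

subsection \<open>Counting itineraries\<close>

lemma infnorm_le_cart: "(\<And>j. \<bar>x $ j\<bar> \<le> K) \<Longrightarrow> infnorm (x :: real^'d) \<le> K"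
  unfolding infnorm_cart by (rule cSup_least) auto

lemma compact_infnorm_le: "compact {z :: real^'d. infnorm z \<le> R}"
proof (rule compact_eq_bounded_closed[THEN iffD2], intro conjI)
  have "norm z \<le> sqrt DIM(real^'d) * R" if "infnorm z \<le> R" for z :: "real^'d"
  proof -
    have "norm z \<le> sqrt DIM(real^'d) * infnorm z" by (rule norm_le_infnorm)
    also have "\<dots> \<le> sqrt DIM(real^'d) * R" using that by (intro mult_left_mono) auto
    finally show ?thesis .
  qed
  then show "bounded {z :: real^'d. infnorm z \<le> R}"
    unfolding bounded_iff by blast
  show "closed {z :: real^'d. infnorm z \<le> R}"
    by (intro closed_Collect_le continuous_intros)
qed

text \<open>At an integer \<open>t\<close> these are the two branches \<open>t\<close> and
  \<open>t - 1\<close> of the floor; at any other \<open>t\<close> both expressions equal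
  \<open>\<lfloor>t\<rfloor>\<close>.\<close>

lemma eventually_floor_near:
  fixes t :: real
  shows "eventually (\<lambda>h. \<lfloor>t + h\<rfloor> = (if 0 \<le> h then \<lfloor>t\<rfloor> else \<lceil>t\<rceil> - 1)) (nhds 0)"
proof -
  define \<delta> where "\<delta> = min (of_int \<lfloor>t\<rfloor> + 1 - t) (t - (of_int \<lceil>t\<rceil> - 1))"
  have "\<delta> > 0" unfolding \<delta>_def by linarith
  then have "eventually (\<lambda>h. dist h 0 < \<delta>) (nhds (0::real))"
    by (auto simp: eventually_nhds_metric)
  then show ?thesis
  proof eventually_elim
    case (elim h)
    then have "\<bar>h\<bar> < of_int \<lfloor>t\<rfloor> + 1 - t" "\<bar>h\<bar> < t - (of_int \<lceil>t\<rceil> - 1)" by (auto simp: \<delta>_def)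
    then show ?case by (intro floor_unique) (auto, linarith+)
  qed
qed

lemma eventually_floor_vec_near:
  fixes u :: "real^'d"
  shows "eventually (\<lambda>h. floor_vec (u + h) =
    (\<chi> j. of_int (if j \<in> {j. 0 \<le> h $ j} then \<lfloor>u $ j\<rfloor> else \<lceil>u $ j\<rceil> - 1))) (nhds 0)"
proof -
  have "filterlim (\<lambda>h. h $ j) (nhds 0) (nhds (0 :: real^'d))" for j
    using tendsto_vec_nth[of "\<lambda>h::real^'d. h" 0 "nhds 0" j] by (simp add: filterlim_ident)
  then have "eventually (\<lambda>h. \<lfloor>u $ j + h $ j\<rfloor> = (if 0 \<le> h $ j then \<lfloor>u $ j\<rfloor> else \<lceil>u $ j\<rceil> - 1)) (nhds 0)" for j
    using eventually_floor_near filterlim_iff by fast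
  then have "eventually (\<lambda>h. \<forall>j. \<lfloor>u $ j + h $ j\<rfloor> = (if 0 \<le> h $ j then \<lfloor>u $ j\<rfloor> else \<lceil>u $ j\<rceil> - 1)) (nhds 0)"
    by (rule eventually_all_finite)
  then show ?thesis
    by eventually_elim (simp add: floor_vec_def vec_eq_iff)
qed

lemma finite_vec_int_bounded: "finite {v :: real^'d. \<forall>j. v $ j \<in> of_int ` {- M..M}}"
proof -
  have "{v :: real^'d. \<forall>j. v $ j \<in> of_int ` {- M..M}}
      \<subseteq> (\<lambda>f. \<chi> j. f j) ` PiE UNIV (\<lambda>_. of_int ` {- M..M})"
  proof
    fix v :: "real^'d" assume "v \<in> {v. \<forall>j. v $ j \<in> of_int ` {- M..M}}"
    then show "v \<in> (\<lambda>f. \<chi> j. f j) ` PiE UNIV (\<lambda>_. of_int ` {- M..M})"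
      by (intro image_eqI[of _ _ "\<lambda>j. v $ j"]) auto
  qed
  moreover have "finite (PiE (UNIV :: 'd set) (\<lambda>_. of_int ` {- M..M} :: real set))"
    by (intro finite_PiE) auto
  ultimately show ?thesis by (meson finite_imageI finite_subset)
qed

text \<open>Passing to the \<open>D\<close>-th root \<open>r\<close> of \<open>l\<close> reduces the
  claim to the convergence of \<open>N * r ^ N\<close> to 0.\<close>

lemma exists_poly_times_power_less_1:
  fixes l :: real
  assumes "0 < l" "l < 1" "D > 0"
  shows "\<exists>N. real ((N * d + 1) ^ D) * l ^ N < 1"
proof -
  define r where "r = root D l"
  have r: "0 < r" "r < 1" "r ^ D = l"
    using assms by (auto simp: r_def real_root_lt_1_iff)
  have "(\<lambda>N. (real d * (real N * r ^ N) + r ^ N) ^ D) \<longlonglongrightarrow> (real d * 0 + 0) ^ D"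
    using r by (intro tendsto_intros powser_times_n_limit_0 LIMSEQ_power_zero) auto
  moreover have "(real d * 0 + 0) ^ D < 1"
    using assms by (simp add: zero_power)
  ultimately have "eventually (\<lambda>N. (real d * (real N * r ^ N) + r ^ N) ^ D < 1) sequentially"
    by (rule order_tendstoD)
  then obtain N where N: "(real d * (real N * r ^ N) + r ^ N) ^ D < 1"
    by (auto simp: eventually_sequentially)
  have "real d * (real N * r ^ N) + r ^ N = real (N * d + 1) * r ^ N"
    by (simp add: algebra_simps)
  then have "(real d * (real N * r ^ N) + r ^ N) ^ D = real ((N * d + 1) ^ D) * l ^ N"
    by (simp add: power_mult_distrib r(3)[symmetric] power_mult[symmetric] mult.commute)
  then show ?thesis using N by auto
qed

lemma measure_slab_le:
  fixes a :: "real^'d"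
  assumes "0 \<le> r"
  shows "measure lebesgue (cbox (\<chi> i. if i = j then t - r else a $ i - 1) (\<chi> i. if i = j then t + r else a $ i + 1))
    \<le> 2 * r * 2 ^ CARD('d)"
proof -
  let ?a = "\<chi> i. if i = j then t - r else a $ i - 1" and ?b = "\<chi> i. if i = j then t + r else a $ i + 1"
  have "measure lebesgue (cbox ?a ?b) = (\<Prod>i\<in>UNIV. if i = j then 2 * r else 2)"
  proof -
    have "\<forall>i. ?a $ i \<le> ?b $ i" using assms by auto
    then have ne: "cbox ?a ?b \<noteq> {}" unfolding interval_ne_empty_cart by blast
    have "measure lebesgue (cbox ?a ?b) = measure lborel (cbox ?a ?b)" by simp
    also have "\<dots> = (\<Prod>i\<in>UNIV. ?b $ i - ?a $ i)" by (rule content_cbox_cart[OF ne])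
    also have "\<dots> = (\<Prod>i\<in>UNIV. if i = j then 2 * r else 2)"
      by (intro prod.cong) auto
    finally show ?thesis .
  qed
  also have "\<dots> = 2 * r * (\<Prod>i\<in>UNIV - {j}. if i = j then 2 * r else 2)"
    by (subst prod.remove[of _ j]) auto
  also have "(\<Prod>i\<in>UNIV - {j}. if i = j then 2 * r else 2) = (2::real) ^ (CARD('d) - 1)"
    by (subst prod.cong[OF refl, of _ _ "\<lambda>_. 2"]) auto
  also have "2 * r * \<dots> \<le> 2 * r * 2 ^ CARD('d)"
    using assms by (intro mult_left_mono power_increasing) auto
  finally show ?thesis .
qed

section \<open>The map in translated coordinates\<close>

locale cart_contraction =
  fixes A :: "real^'d^'d" and l :: real
  assumes l: "0 < l" "l < 1" and contr: "infnorm (A *v x) \<le> l * infnorm x"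
begin

lemma linear_iter: "linear (((*v) A) ^^ k)"
proof (induction k)
  case 0
  show ?case by (simp add: linear_iff)
next
  case (Suc k)
  then show ?case using linear_compose[OF Suc matrix_vector_mul_linear[of A]] by (simp add: comp_def)
qed

lemma infnorm_iter_le: "infnorm ((((*v) A) ^^ k) x) \<le> l ^ k * infnorm x"
proof (induction k)
  case (Suc k)
  have "infnorm (A *v ((((*v) A) ^^ k) x)) \<le> l * infnorm ((((*v) A) ^^ k) x)" by (rule contr)
  also have "\<dots> \<le> l * (l ^ k * infnorm x)" using Suc l by (intro mult_left_mono) auto
  finally show ?case by simp
qed simp

text \<open>
  If \<open>b = c - A c\<close> then \<open>g c\<close> is the map \<open>affine_mod1 A b\<close> translated by \<open>- c\<close>. In these coordinates
  the parameter enters only through the integer vectors, so the value of \<open>W c n z\<close>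
  is a function of the itinerary alone.
\<close>

definition g :: "real^'d \<Rightarrow> real^'d \<Rightarrow> real^'d"
  where "g c z = A *v z - floor_vec (A *v z + c)"

definition W :: "real^'d \<Rightarrow> nat \<Rightarrow> real^'d \<Rightarrow> real^'d"
  where "W c n z = (g c ^^ n) z - (((*v) A) ^^ n) z"

lemma W_0: "W c 0 z = 0"
  by (simp add: W_def)

lemma g_iter_eq: "(g c ^^ n) z = (((*v) A) ^^ n) z + W c n z"
  by (simp add: W_def)

text \<open>For a fixed value of \<open>W c n z\<close> the argument of the floor is affine in
  \<open>(z, c)\<close>, with a linear part that does not involve that value.\<close>

lemma W_Suc: "W c (Suc n) z = A *v W c n z - floor_vec ((((*v) A) ^^ Suc n) z + A *v W c n z + c)"
proof -
  have "(g c ^^ Suc n) z = g c ((((*v) A) ^^ n) z + W c n z)"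
    by (simp add: g_iter_eq)
  then show ?thesis
    by (simp add: W_def[of c "Suc n"]) (simp add: g_def matrix_vector_right_distrib algebra_simps)
qed

text \<open>A cocycle identity: once \<open>W c m z\<close> is known, only the next \<open>N\<close>
  steps from \<open>(g c ^^ m) z\<close> contribute. This drives the inductive count.\<close>

lemma W_add: "W c (N + m) z = W c N ((g c ^^ m) z) + (((*v) A) ^^ N) (W c m z)"
proof -
  have "(((*v) A) ^^ N) (W c m z) = (((*v) A) ^^ N) ((g c ^^ m) z) - (((*v) A) ^^ (N + m)) z"
    unfolding W_def by (simp add: linear_diff[OF linear_iter] funpow_add)
  then show ?thesis
    unfolding W_def[of c N] W_def[of c "N + m"] by (simp add: funpow_add)
qed

lemma infnorm_g_le: "infnorm (g c z) \<le> 1 + infnorm c"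
proof -
  have "infnorm (g c z + c) \<le> 1"
    by (rule infnorm_le_cart) (simp add: g_def floor_vec_def, linarith)
  moreover have "infnorm (g c z) \<le> infnorm (g c z + c) + infnorm c"
    using infnorm_triangle[of "g c z + c" "- c"] by (simp add: infnorm_neg)
  ultimately show ?thesis by linarith
qed

lemma infnorm_g_iter_le: "\<lbrakk>infnorm z \<le> R; 1 + infnorm c \<le> R\<rbrakk> \<Longrightarrow> infnorm ((g c ^^ n) z) \<le> R"
  using infnorm_g_le by (cases n) (auto intro: order_trans)

section \<open>Local bounds on the number of itineraries\<close>

text \<open>\<open>side (k, j) h\<close> is the change of coordinate \<open>j\<close> of the floor
  argument in step \<open>k + 1\<close> when start and parameter move by \<open>h\<close> and the
  earlier itinerary is kept.\<close>

definition side :: "nat \<times> 'd \<Rightarrow> (real^'d) \<times> (real^'d) \<Rightarrow> real"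
  where "side i h = ((((*v) A) ^^ Suc (fst i)) (fst h) + snd h) $ snd i"

lemma linear_side: "linear (side i)"
  unfolding side_def
  by (rule linearI)
    (simp_all only: fst_add snd_add fst_scaleR snd_scaleR linear_add[OF linear_iter]
      linear_cmul[OF linear_iter] vector_add_component vector_scaleR_component algebra_simps real_scaleR_def)

definition sides :: "nat \<Rightarrow> (real^'d) \<times> (real^'d) \<Rightarrow> (nat \<times> 'd) set"
  where "sides N h = {i \<in> {..<N} \<times> UNIV. 0 \<le> side i h}"

text \<open>
  The hyperplanes met by an itinerary through \<open>p\<close> have directions independent of the
  itinerary, because every branch of \<open>g c\<close> has linear part \<open>A\<close>.
\<close>

lemma W_locally_determined_by_sides:
  "\<exists>\<Phi>. eventually (\<lambda>p. W (snd p) N (fst p) = \<Phi> (sides N (p - p0))) (nhds p0)"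
proof (induction N)
  case 0
  show ?case by (rule exI[of _ "\<lambda>_. 0"]) (simp add: W_0)
next
  case (Suc N)
  then obtain \<Phi> where \<Phi>: "eventually (\<lambda>p. W (snd p) N (fst p) = \<Phi> (sides N (p - p0))) (nhds p0)"
    by blast
  \<comment> \<open>Near \<open>p0\<close> these finitely many values are the only ones of
    \<open>W\<close>, so one neighbourhood serves the floor expansions at all base points
    \<open>u w\<close>.\<close>
  define F where "F = \<Phi> ` Pow ({..<N} \<times> (UNIV :: 'd set))"
  define u where "u w = (((*v) A) ^^ Suc N) (fst p0) + A *v w + snd p0" for w
  define fl where "fl w J = (\<chi> j. of_int (if j \<in> J then \<lfloor>u w $ j\<rfloor> else \<lceil>u w $ j\<rceil> - 1) :: real^'d)" for w J
  define h where "h p = (((*v) A) ^^ Suc N) (fst p - fst p0) + (snd p - snd p0)" for p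
  have "filterlim h (nhds 0) (nhds p0)"
  proof -
    have "isCont h p0"
      unfolding h_def by (intro continuous_intros linear_continuous_at[OF linear_conv_bounded_linear[THEN iffD1, OF linear_iter], THEN isCont_o2[rotated]])
    moreover have "h p0 = 0" by (simp add: h_def linear_0[OF linear_iter] del: funpow.simps)
    ultimately show ?thesis
      using continuous_at_imp_continuous_at_within tendsto_at_iff_tendsto_nhds[of h p0] by (simp add: isCont_def)
  qed
  then have "eventually (\<lambda>p. floor_vec (u w + h p) = fl w {j. 0 \<le> h p $ j}) (nhds p0)" for w
    using eventually_floor_vec_near[of "u w"] unfolding fl_def filterlim_iff by fast
  moreover have "finite F" by (simp add: F_def)
  ultimately have ev: "eventually (\<lambda>p. \<forall>w\<in>F. floor_vec (u w + h p) = fl w {j. 0 \<le> h p $ j}) (nhds p0)"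
    by (simp add: eventually_ball_finite)
  \<comment> \<open>The first \<open>N\<close> layers of signs determine \<open>w\<close>; the last
    layer selects the branch of each floor.\<close>
  define \<Phi>' where "\<Phi>' S = (let w = \<Phi> (S \<inter> {..<N} \<times> UNIV) in A *v w - fl w {j. (N, j) \<in> S})" for S
  from ev \<Phi> have "eventually (\<lambda>p. W (snd p) (Suc N) (fst p) = \<Phi>' (sides (Suc N) (p - p0))) (nhds p0)"
  proof eventually_elim
    case (elim p)
    have 1: "sides (Suc N) (p - p0) \<inter> {..<N} \<times> UNIV = sides N (p - p0)"
      by (auto simp: sides_def)
    have 2: "{j. (N, j) \<in> sides (Suc N) (p - p0)} = {j. 0 \<le> h p $ j}"
      by (simp add: sides_def side_def h_def)
    have "W (snd p) N (fst p) \<in> F"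
      using elim(2) by (auto simp: F_def sides_def)
    moreover have "(((*v) A) ^^ Suc N) (fst p) + A *v w + snd p = u w + h p" for w
      by (simp add: u_def h_def linear_diff[OF linear_iter] del: funpow.simps)
    ultimately have "W (snd p) (Suc N) (fst p)
        = A *v W (snd p) N (fst p) - fl (W (snd p) N (fst p)) {j. 0 \<le> h p $ j}"
      using elim(1) unfolding W_Suc by simp
    then show ?case using elim(2) by (simp add: 1 2 Let_def \<Phi>'_def)
  qed
  then show ?case by blast
qed

text \<open>The bound of \<open>card_sign_patterns\<close> for \<open>N * CARD('d)\<close>
  functionals on pairs of vectors, a space of dimension \<open>2 * CARD('d)\<close>.\<close>

definition P :: "nat \<Rightarrow> nat"
  where "P N = (N * CARD('d) + 1) ^ (2 * CARD('d))"

lemma W_local_count: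
  obtains G where "open G" "p0 \<in> G"
    "finite ((\<lambda>p. W (snd p) N (fst p)) ` G)" "card ((\<lambda>p. W (snd p) N (fst p)) ` G) \<le> P N"
proof -
  obtain \<Phi> where "eventually (\<lambda>p. W (snd p) N (fst p) = \<Phi> (sides N (p - p0))) (nhds p0)"
    using W_locally_determined_by_sides by blast
  then obtain G where G: "open G" "p0 \<in> G" "\<And>p. p \<in> G \<Longrightarrow> W (snd p) N (fst p) = \<Phi> (sides N (p - p0))"
    unfolding eventually_nhds by blast
  have sub: "(\<lambda>p. W (snd p) N (fst p)) ` G \<subseteq> \<Phi> ` (sides N ` UNIV)"
    using G(3) by auto
  have fin: "finite (sides N ` UNIV)"
    by (rule finite_subset[of _ "Pow ({..<N} \<times> UNIV)"]) (auto simp: sides_def)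
  have "card ((\<lambda>p. W (snd p) N (fst p)) ` G) \<le> card (\<Phi> ` (sides N ` UNIV))"
    using sub fin by (intro card_mono) auto
  also have "\<dots> \<le> card (sides N ` UNIV)"
    using fin by (rule card_image_le)
  also have "\<dots> \<le> (card ({..<N} \<times> (UNIV :: 'd set)) + 1) ^ dim (UNIV :: ((real^'d) \<times> (real^'d)) set)"
    unfolding sides_def by (rule card_sign_patterns) (auto simp: linear_side)
  also have "\<dots> = P N"
    by (simp add: P_def card_cartesian_product mult_2)
  finally show ?thesis using that G(1,2) sub fin finite_subset by blast
qed

text \<open>A Lebesgue number of the cover by the sets from \<open>W_local_count\<close> gives one
  radius that serves all starting points \<open>z0\<close>.\<close>

lemma W_uniform_count:
  "\<exists>\<delta>>0. \<forall>z0. infnorm z0 \<le> R \<longrightarrow> finite {W c N z | c z. dist c c0 < \<delta> \<and> dist z z0 < \<delta>} \<and>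
     card {W c N z | c z. dist c c0 < \<delta> \<and> dist z z0 < \<delta>} \<le> P N"
proof -
  define \<G> where "\<G> = {G. open G \<and> finite ((\<lambda>p. W (snd p) N (fst p)) ` G)
    \<and> card ((\<lambda>p. W (snd p) N (fst p)) ` G) \<le> P N}"
  have cpt: "compact ({z :: real^'d. infnorm z \<le> R} \<times> {c0})"
    by (intro compact_Times compact_infnorm_le) auto
  have cov: "{z. infnorm z \<le> R} \<times> {c0} \<subseteq> \<Union>\<G>"
  proof
    fix p0 :: "(real^'d) \<times> (real^'d)"
    obtain G where "open G" "p0 \<in> G"
      "finite ((\<lambda>p. W (snd p) N (fst p)) ` G)" "card ((\<lambda>p. W (snd p) N (fst p)) ` G) \<le> P N"
      using W_local_count by blast
    then show "p0 \<in> \<Union>\<G>" unfolding \<G>_def by blast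
  qed
  have opn: "\<And>G. G \<in> \<G> \<Longrightarrow> open G" by (simp add: \<G>_def)
  obtain e where e: "e > 0"
    "\<And>p. p \<in> {z. infnorm z \<le> R} \<times> {c0} \<Longrightarrow> \<exists>G\<in>\<G>. ball p e \<subseteq> G"
    using Heine_Borel_lemma[OF cpt cov opn] by blast
  show ?thesis
  proof (intro exI[of _ "e / 2"] conjI allI impI)
    fix z0 :: "real^'d" assume "infnorm z0 \<le> R"
    then obtain G where G: "G \<in> \<G>" "ball (z0, c0) e \<subseteq> G" using e(2)[of "(z0, c0)"] by auto
    have "{W c N z | c z. dist c c0 < e/2 \<and> dist z z0 < e/2} \<subseteq> (\<lambda>p. W (snd p) N (fst p)) ` G"
    proof safe
      fix c z assume *: "dist c c0 < e/2" "dist z z0 < e/2"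
      have "dist (z0, c0) (z, c) \<le> dist z0 z + dist c0 c"
        unfolding dist_Pair_Pair by (rule sqrt_sum_squares_le_sum) auto
      then have "(z, c) \<in> G" using * G(2) by (auto simp: dist_commute)
      then show "W c N z \<in> (\<lambda>p. W (snd p) N (fst p)) ` G"
        by (intro image_eqI[of _ _ "(z, c)"]) auto
    qed
    then show "finite {W c N z | c z. dist c c0 < e/2 \<and> dist z z0 < e/2}"
      "card {W c N z | c z. dist c c0 < e/2 \<and> dist z z0 < e/2} \<le> P N"
      using G(1) unfolding \<G>_def by (auto intro: finite_subset order_trans[OF card_mono])
  qed (use e in auto)
qed

section \<open>Growth of the number of itineraries\<close>

definition Ws :: "(real^'d) set \<Rightarrow> real \<Rightarrow> nat \<Rightarrow> (real^'d) set"
  where "Ws U R n = {W c n z | c z. c \<in> U \<and> infnorm z \<le> R}"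

text \<open>All orbits stay bounded by \<open>R\<close>, so each step subtracts an integer vector
  from a fixed finite set.\<close>

lemma finite_Ws:
  assumes "\<And>c. c \<in> U \<Longrightarrow> 1 + infnorm c \<le> R"
  shows "finite (Ws U R n)"
proof (induction n)
  case 0
  show ?case by (rule finite_subset[of _ "{0}"]) (auto simp: Ws_def W_0)
next
  case (Suc n)
  define M where "M = \<lceil>2 * R\<rceil> + 1"
  define I where "I = {v :: real^'d. \<forall>j. v $ j \<in> of_int ` {- M..M}}"
  have "Ws U R (Suc n) \<subseteq> (\<Union>w\<in>Ws U R n. (\<lambda>i. A *v w - i) ` I)"
  proof
    fix w assume "w \<in> Ws U R (Suc n)"
    then obtain c z where cz: "w = W c (Suc n) z" "c \<in> U" "infnorm z \<le> R" by (auto simp: Ws_def)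
    define y where "y = A *v (g c ^^ n) z + c"
    have "infnorm (A *v (g c ^^ n) z) \<le> l * infnorm ((g c ^^ n) z)" by (rule contr)
    also have "\<dots> \<le> 1 * R"
      using l cz assms infnorm_pos_le by (intro mult_mono infnorm_g_iter_le) auto
    finally have "infnorm y \<le> 2 * R"
      using infnorm_triangle[of "A *v (g c ^^ n) z" c] assms[OF cz(2)] by (simp add: y_def)
    then have "\<bar>y $ j\<bar> \<le> 2 * R" for j
      using component_le_infnorm_cart order_trans by blast
    then have y: "y $ j \<le> 2 * R" "- (2 * R) \<le> y $ j" for j
      by (auto simp: abs_le_iff minus_le_iff)
    have "\<lfloor>y $ j\<rfloor> \<in> {- M..M}" for j
      unfolding M_def using y[of j] by (auto intro: order_trans[OF floor_mono floor_le_ceiling]) linarith+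
    then have "floor_vec y \<in> I" by (auto simp: I_def floor_vec_def)
    moreover have "w = A *v W c n z - floor_vec y"
      unfolding cz(1) W_Suc y_def by (simp add: g_iter_eq matrix_vector_right_distrib)
    moreover have "W c n z \<in> Ws U R n" using cz by (auto simp: Ws_def)
    ultimately show "w \<in> (\<Union>w\<in>Ws U R n. (\<lambda>i. A *v w - i) ` I)" by blast
  qed
  moreover have "finite (\<Union>w\<in>Ws U R n. (\<lambda>i. A *v w - i) ` I)"
    unfolding I_def by (intro finite_UN_I Suc finite_imageI finite_vec_int_bounded)
  ultimately show ?case by (rule finite_subset)
qed

text \<open>
  All points \<open>(g c ^^ m) z\<close> sharing the value \<open>W c m z\<close> lie in a set of diameter
  \<open>O(l ^ m)\<close>, so the local bound \<open>P N\<close> applies to their next \<open>N\<close> steps.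
\<close>

lemma card_Ws_add_le:
  assumes U: "\<And>c. c \<in> U \<Longrightarrow> 1 + infnorm c \<le> R" "\<And>c. c \<in> U \<Longrightarrow> dist c c0 < \<delta>"
    and \<delta>: "\<And>z0. infnorm z0 \<le> R \<Longrightarrow> finite {W c N z | c z. dist c c0 < \<delta> \<and> dist z z0 < \<delta>} \<and>
       card {W c N z | c z. dist c c0 < \<delta> \<and> dist z z0 < \<delta>} \<le> P N"
    and m: "sqrt DIM(real^'d) * (2 * R * l ^ m) < \<delta>"
  shows "card (Ws U R (N + m)) \<le> card (Ws U R m) * P N"
proof -
  define V where "V w = {W c N ((g c ^^ m) z) | c z. c \<in> U \<and> infnorm z \<le> R \<and> W c m z = w}" for w
  have V: "finite (V w) \<and> card (V w) \<le> P N" if w: "w \<in> Ws U R m" for w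
  proof -
    obtain c1 z1 where 1: "w = W c1 m z1" "c1 \<in> U" "infnorm z1 \<le> R"
      using w by (auto simp: Ws_def)
    define z0 where "z0 = (g c1 ^^ m) z1"
    have z0: "infnorm z0 \<le> R" unfolding z0_def using 1 U by (intro infnorm_g_iter_le) auto
    have "V w \<subseteq> {W c N z | c z. dist c c0 < \<delta> \<and> dist z z0 < \<delta>}"
    proof
      fix v assume "v \<in> V w"
      then obtain c z where cz: "v = W c N ((g c ^^ m) z)" "c \<in> U" "infnorm z \<le> R" "W c m z = w"
        by (auto simp: V_def)
      have "(g c ^^ m) z - z0 = (((*v) A) ^^ m) (z - z1)"
        using cz 1 by (simp add: z0_def g_iter_eq linear_diff[OF linear_iter])
      then have "infnorm ((g c ^^ m) z - z0) \<le> l ^ m * infnorm (z - z1)"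
        using infnorm_iter_le by simp
      also have "\<dots> \<le> l ^ m * (2 * R)"
        using infnorm_triangle[of z "- z1"] cz 1 l
        by (intro mult_left_mono) (auto simp: infnorm_neg)
      finally have "infnorm ((g c ^^ m) z - z0) \<le> 2 * R * l ^ m" by (simp add: mult.commute)
      then have "sqrt DIM(real^'d) * infnorm ((g c ^^ m) z - z0) \<le> sqrt DIM(real^'d) * (2 * R * l ^ m)"
        by (rule mult_left_mono) simp
      then have "sqrt DIM(real^'d) * infnorm ((g c ^^ m) z - z0) < \<delta>"
        using m by linarith
      then have "dist ((g c ^^ m) z) z0 < \<delta>"
        unfolding dist_norm using norm_le_infnorm[of "(g c ^^ m) z - z0"] by linarith
      then show "v \<in> {W c N z | c z. dist c c0 < \<delta> \<and> dist z z0 < \<delta>}"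
        using cz U(2) by blast
    qed
    then show ?thesis using \<delta>[OF z0] by (meson card_mono finite_subset order_trans)
  qed
  have sub: "Ws U R (N + m) \<subseteq> (\<Union>w\<in>Ws U R m. (\<lambda>v. v + (((*v) A) ^^ N) w) ` V w)"
    by (fastforce simp: Ws_def V_def W_add)
  have fin: "finite (Ws U R m)" using U(1) by (rule finite_Ws)
  have "card (Ws U R (N + m)) \<le> card (\<Union>w\<in>Ws U R m. (\<lambda>v. v + (((*v) A) ^^ N) w) ` V w)"
    using sub fin V by (intro card_mono) auto
  also have "\<dots> \<le> (\<Sum>w\<in>Ws U R m. card ((\<lambda>v. v + (((*v) A) ^^ N) w) ` V w))"
    using fin by (rule card_UN_le)
  also have "\<dots> \<le> (\<Sum>w\<in>Ws U R m. P N)"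
    using V by (intro sum_mono) (meson card_image_le order_trans)
  finally show ?thesis by simp
qed

text \<open>Once \<open>m\<close> steps have brought the diameters in \<open>card_Ws_add_le\<close>
  below the uniform radius, each further block of \<open>N\<close> steps multiplies the count by at
  most \<open>P N\<close>.\<close>

lemma card_Ws_growth:
  assumes R: "\<And>c. dist c c0 < 1 \<Longrightarrow> 1 + infnorm c \<le> R"
  obtains \<delta> m C where "0 < \<delta>" "\<delta> \<le> 1" "\<And>k. card (Ws (ball c0 \<delta>) R (k * N + m)) \<le> C * P N ^ k"
proof -
  obtain \<delta>' where \<delta>': "\<delta>' > 0"
    "\<And>z0. infnorm z0 \<le> R \<Longrightarrow> finite {W c N z | c z. dist c c0 < \<delta>' \<and> dist z z0 < \<delta>'} \<and>
       card {W c N z | c z. dist c c0 < \<delta>' \<and> dist z z0 < \<delta>'} \<le> P N"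
    using W_uniform_count[of R N c0] by blast
  define \<delta> where "\<delta> = min \<delta>' 1"
  have U: "1 + infnorm c \<le> R" "dist c c0 < \<delta>'" if "c \<in> ball c0 \<delta>" for c
    using that R by (auto simp: \<delta>_def dist_commute)
  have "(\<lambda>m. sqrt DIM(real^'d) * (2 * R * l ^ m)) \<longlonglongrightarrow> sqrt DIM(real^'d) * (2 * R * 0)"
    using l by (intro tendsto_intros LIMSEQ_power_zero) auto
  moreover have "sqrt DIM(real^'d) * (2 * R * 0) < \<delta>'" using \<delta>'(1) by simp
  ultimately have "eventually (\<lambda>m. sqrt DIM(real^'d) * (2 * R * l ^ m) < \<delta>') sequentially"
    by (rule order_tendstoD)
  then obtain m where m: "\<And>m'. m' \<ge> m \<Longrightarrow> sqrt DIM(real^'d) * (2 * R * l ^ m') < \<delta>'"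
    by (auto simp: eventually_sequentially)
  have "card (Ws (ball c0 \<delta>) R (k * N + m)) \<le> card (Ws (ball c0 \<delta>) R m) * P N ^ k" for k
  proof (induction k)
    case (Suc k)
    have "card (Ws (ball c0 \<delta>) R (N + (k * N + m))) \<le> card (Ws (ball c0 \<delta>) R (k * N + m)) * P N"
      using U \<delta>'(2) m by (intro card_Ws_add_le[where \<delta> = \<delta>' and ?c0.0 = c0]) auto
    also have "\<dots> \<le> card (Ws (ball c0 \<delta>) R m) * P N ^ k * P N"
      using Suc by (intro mult_right_mono) auto
    finally show ?case by (simp add: ac_simps)
  qed simp
  then show ?thesis using that[of \<delta>] \<delta>' by (auto simp: \<delta>_def)
qed

subsection \<open>Exceptional parameters\<close>

text \<open>The distance is taken between the floor argument and the integers, not in phase space,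
  so that failure directly confines a coordinate of \<open>c\<close>. The point in original
  coordinates is \<open>z + c\<close>.\<close>

definition margin :: "real^'d \<Rightarrow> nat \<Rightarrow> real \<Rightarrow> bool"
  where "margin c n \<eta> \<longleftrightarrow> (\<forall>z. z + c \<in> unit_cube \<longrightarrow>
    (\<forall>j (q::int). \<eta> \<le> \<bar>(A *v (g c ^^ n) z + c) $ j - of_int q\<bar>))"

text \<open>Failure at time \<open>n\<close> confines \<open>c\<close> to finitely many slabs of
  width \<open>O(l ^ n)\<close>. For \<open>n = k * N + m\<close> their total measure is at most a
  constant times \<open>(P N * l ^ N) ^ k\<close>.\<close>

lemma locally_negligible_no_margin:
  "\<exists>\<delta>>0. negligible ({c. \<not> (\<exists>n. \<exists>\<eta>>0. margin c n \<eta>)} \<inter> ball c0 \<delta>)"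
proof -
  define R where "R = infnorm c0 + 2"
  have R: "1 + infnorm c \<le> R" if "dist c c0 < 1" for c
    using infnorm_triangle[of "c - c0" c0] infnorm_le_norm[of "c - c0"] that
    by (simp add: R_def dist_norm)
  have R0: "R > 0" using infnorm_pos_le[of c0] by (simp add: R_def)
  \<comment> \<open>This fixes the block length: over one block, contraction outweighs
    branching.\<close>
  obtain N where N: "real (P N) * l ^ N < 1"
    unfolding P_def using exists_poly_times_power_less_1[OF l, of "2 * CARD('d)" "CARD('d)"] by auto
  obtain \<delta> m C where \<delta>: "0 < \<delta>" "\<delta> \<le> 1"
    and C: "\<And>k. card (Ws (ball c0 \<delta>) R (k * N + m)) \<le> C * P N ^ k"
    using card_Ws_growth[OF R] by blast
  define U where "U = ball c0 \<delta>"
  have UR: "1 + infnorm c \<le> R" if "c \<in> U" for c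
    using that \<delta> R by (auto simp: U_def dist_commute)
  define Q where "Q = \<lceil>5 * R\<rceil>"
  define B where "B = {c. \<not> (\<exists>n. \<exists>\<eta>>0. margin c n \<eta>)} \<inter> U"
  \<comment> \<open>The slab is centred at the value of \<open>c $ j\<close> for which the floor
    argument, without the contracted contribution of \<open>z\<close>, equals \<open>q\<close>. The
    other coordinates stay within 1 of those of \<open>c0\<close>.\<close>
  define S where "S n = (\<lambda>(w, j, q :: int). cbox
      (\<chi> i. if i = j then (of_int q - (A *v w) $ j) - 2 * R * l ^ n else c0 $ i - 1)
      (\<chi> i. if i = j then (of_int q - (A *v w) $ j) + 2 * R * l ^ n else c0 $ i + 1))" for n
  define I where "I n = Ws U R n \<times> (UNIV :: 'd set) \<times> {- Q..Q}" for n
  have finI: "finite (I n)" for n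
    using finite_Ws[OF UR] by (simp add: I_def)
  have sub: "B \<subseteq> (\<Union>i\<in>I n. S n i)" for n
  proof
    fix c assume c: "c \<in> B"
    \<comment> \<open>The margin fails for every positive width; this one has the order of the
      contracted contribution of \<open>z\<close>.\<close>
    then have "\<not> margin c n (R * l ^ n)" and cU: "c \<in> U"
      using R0 l by (auto simp: B_def)
    then obtain z j q where z: "z + c \<in> unit_cube"
      and q: "\<bar>(A *v (g c ^^ n) z + c) $ j - of_int q\<bar> < R * l ^ n"
      by (auto simp: margin_def not_le)
    have "infnorm (z + c) \<le> 1"
      using z by (intro infnorm_le_cart) (auto simp: unit_cube_def intro: less_imp_le)
    then have zR: "infnorm z \<le> R"
      using infnorm_triangle[of "z + c" "- c"] UR[OF cU] by (simp add: infnorm_neg)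
    define w where "w = W c n z"
    have ln: "l ^ n \<le> 1" "l ^ Suc n \<le> l ^ n" using l by (auto intro: power_le_one simp: mult_le_cancel_right1)
    have "\<bar>((((*v) A) ^^ Suc n) z) $ j\<bar> \<le> infnorm ((((*v) A) ^^ Suc n) z)"
      by (rule component_le_infnorm_cart)
    also have "\<dots> \<le> l ^ Suc n * infnorm z" by (rule infnorm_iter_le)
    also have "\<dots> \<le> l ^ n * R"
      using ln zR l by (intro mult_mono infnorm_pos_le) auto
    finally have 1: "\<bar>((((*v) A) ^^ Suc n) z) $ j\<bar> \<le> R * l ^ n" by (simp add: mult.commute)
    have "A *v (g c ^^ n) z = (((*v) A) ^^ Suc n) z + A *v w"
      by (simp add: w_def g_iter_eq matrix_vector_right_distrib)
    then have 2: "(A *v (g c ^^ n) z + c) $ j = ((((*v) A) ^^ Suc n) z) $ j + (A *v w) $ j + c $ j"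
      by simp
    \<comment> \<open>One \<open>R * l ^ n\<close> comes from the failed margin, the other from
      dropping the contribution of \<open>z\<close>.\<close>
    have *: "\<bar>(A *v w) $ j + c $ j - of_int q\<bar> \<le> 2 * R * l ^ n"
      using q 1 unfolding 2 by linarith
    have "\<bar>(A *v (g c ^^ n) z) $ j\<bar> \<le> infnorm (A *v (g c ^^ n) z)" by (rule component_le_infnorm_cart)
    also have "\<dots> \<le> l * infnorm ((g c ^^ n) z)" by (rule contr)
    also have "\<dots> \<le> 1 * R"
      using l zR UR[OF cU] by (intro mult_mono infnorm_g_iter_le infnorm_pos_le) auto
    finally have "\<bar>(A *v (g c ^^ n) z) $ j\<bar> \<le> R" by simp
    moreover have "\<bar>c $ j\<bar> \<le> R"
      using component_le_infnorm_cart[of c j] UR[OF cU] by linarith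
    moreover have "R * l ^ n \<le> R" using ln R0 by simp
    ultimately have "\<bar>real_of_int q\<bar> \<le> 5 * R"
      using q R0 unfolding vector_add_component by linarith
    then have "q \<in> {- Q..Q}" unfolding Q_def by (auto simp: abs_le_iff le_ceiling_iff ceiling_le_iff) linarith+
    moreover have "w \<in> Ws U R n" using cU zR by (auto simp: Ws_def w_def)
    ultimately have "(w, j, q) \<in> I n" by (simp add: I_def)
    moreover have "\<bar>c $ i - c0 $ i\<bar> \<le> 1" for i
      using component_le_norm_cart[of "c - c0" i] cU \<delta> by (simp add: U_def dist_norm norm_minus_commute)
    then have "c0 $ i - 1 \<le> c $ i \<and> c $ i \<le> c0 $ i + 1" for i
      by (smt (verit))
    then have "c \<in> S n (w, j, q)"
      using * by (auto simp: S_def mem_box_cart)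
    ultimately show "c \<in> (\<Union>i\<in>I n. S n i)" by blast
  qed
  have measS: "measure lebesgue (S n i) \<le> 2 * (2 * R * l ^ n) * 2 ^ CARD('d)" for n i
  proof -
    obtain w j q where "i = (w, j, q)" by (cases i)
    then show ?thesis
      unfolding S_def using R0 l by (simp only: prod.case) (rule measure_slab_le, simp)
  qed
  have lmS: "S n i \<in> lmeasurable" for n i
    unfolding S_def by (auto split: prod.split)
  define K where "K = real C * real (CARD('d) * card {- Q..Q}) * (4 * R * l ^ m * 2 ^ CARD('d))"
  have le: "measure lebesgue (\<Union>i\<in>I (k * N + m). S (k * N + m) i) \<le> K * (real (P N) * l ^ N) ^ k" for k
  proof -
    let ?n = "k * N + m"
    have "measure lebesgue (\<Union>i\<in>I ?n. S ?n i) \<le> (\<Sum>i\<in>I ?n. measure lebesgue (S ?n i))"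
      using finI lmS by (intro measure_UNION_le) auto
    also have "\<dots> \<le> real (card (I ?n)) * (2 * (2 * R * l ^ ?n) * 2 ^ CARD('d))"
      using measS by (intro sum_bounded_above)
    also have "real (card (I ?n)) \<le> real (C * P N ^ k * (CARD('d) * card {- Q..Q}))"
      using C[of k] unfolding I_def U_def card_cartesian_product of_nat_le_iff by (rule mult_right_mono) simp
    also have "real (C * P N ^ k * (CARD('d) * card {- Q..Q})) * (2 * (2 * R * l ^ ?n) * 2 ^ CARD('d))
        = K * (real (P N) * l ^ N) ^ k"
      by (simp add: K_def power_add power_mult power_mult_distrib mult.commute[of k N])
    finally show ?thesis using R0 l by (simp add: mult_right_mono)
  qed
  have "(\<lambda>k. K * (real (P N) * l ^ N) ^ k) \<longlonglongrightarrow> K * 0"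
    using N l by (intro tendsto_intros LIMSEQ_power_zero) auto
  then have lim: "(\<lambda>k. K * (real (P N) * l ^ N) ^ k) \<longlonglongrightarrow> 0" by simp
  have "negligible B"
    unfolding negligible_outer_le
  proof (intro allI impI)
    fix e :: real assume "e > 0"
    with lim have "eventually (\<lambda>k. K * (real (P N) * l ^ N) ^ k < e) sequentially"
      by (rule order_tendstoD)
    then obtain k where k: "K * (real (P N) * l ^ N) ^ k < e"
      by (auto simp: eventually_sequentially)
    let ?n = "k * N + m"
    have "(\<Union>i\<in>I ?n. S ?n i) \<in> lmeasurable"
      using finI lmS by (intro fmeasurable.finite_UN) auto
    moreover have "measure lebesgue (\<Union>i\<in>I ?n. S ?n i) \<le> e"
      using le[of k] k by linarith
    ultimately show "\<exists>T. B \<subseteq> T \<and> T \<in> lmeasurable \<and> measure lebesgue T \<le> e"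
      using sub[of ?n] by blast
  qed
  then show ?thesis using \<delta>(1) unfolding B_def U_def by blast
qed

text \<open>Negligibility is a local property, since countably many of the local neighbourhoods
  cover the set.\<close>

lemma negligible_no_margin: "negligible {c. \<not> (\<exists>n. \<exists>\<eta>>0. margin c n \<eta>)}" (is "negligible ?B")
  unfolding locally_negligible_alt[of ?B]
proof
  fix c assume c: "c \<in> ?B"
  obtain \<delta> where "\<delta> > 0" "negligible (?B \<inter> ball c \<delta>)"
    using locally_negligible_no_margin by blast
  then show "\<exists>U. openin (top_of_set ?B) U \<and> c \<in> U \<and> negligible U"
    using c by (intro exI[of _ "?B \<inter> ball c \<delta>"]) (auto simp: openin_open_Int)
qed

section \<open>Return to the original map and parameter\<close>

lemma affine_mod1_conjugate:
  assumes "b = c - A *v c"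
  shows "(affine_mod1 A b ^^ n) x = (g c ^^ n) (x - c) + c"
proof (induction n)
  case (Suc n)
  have "affine_mod1 A b (y + c) = g c y + c" for y
    by (simp add: affine_mod1_def g_def assms matrix_vector_right_distrib algebra_simps)
  then show ?case using Suc by simp
qed simp

text \<open>The floor arguments differ by less than \<open>\<eta>\<close> while each keeps distance
  \<open>\<eta>\<close> from the integers. No integer separates them, so the floors cancel.\<close>

lemma infnorm_affine_mod1_diff_le:
  assumes x: "\<And>j (q::int). \<eta> \<le> \<bar>(A *v x + b) $ j - of_int q\<bar>"
    and y: "\<And>j (q::int). \<eta> \<le> \<bar>(A *v y + b) $ j - of_int q\<bar>"
    and xy: "infnorm (x - y) < \<eta>"
  shows "infnorm (affine_mod1 A b x - affine_mod1 A b y) \<le> l * infnorm (x - y)"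
proof -
  have "\<lfloor>(A *v x + b) $ j\<rfloor> = \<lfloor>(A *v y + b) $ j\<rfloor>" for j
  proof -
    let ?u = "(A *v x + b) $ j" and ?v = "(A *v y + b) $ j"
    have "\<bar>?u - ?v\<bar> = \<bar>(A *v (x - y)) $ j\<bar>"
      by (simp add: matrix_vector_mult_diff_distrib)
    also have "\<dots> \<le> infnorm (A *v (x - y))" by (rule component_le_infnorm_cart)
    also have "\<dots> \<le> l * infnorm (x - y)" by (rule contr)
    also have "\<dots> \<le> 1 * infnorm (x - y)" using l by (intro mult_right_mono infnorm_pos_le) auto
    finally have uv: "\<bar>?u - ?v\<bar> < \<eta>" using xy by simp
    have "\<not> \<lfloor>?u\<rfloor> < \<lfloor>?v\<rfloor>"
      using uv x[of j "\<lfloor>?v\<rfloor>"] by linarith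
    moreover have "\<not> \<lfloor>?v\<rfloor> < \<lfloor>?u\<rfloor>"
      using uv y[of j "\<lfloor>?u\<rfloor>"] by linarith
    ultimately show ?thesis by linarith
  qed
  then have "floor_vec (A *v x + b) = floor_vec (A *v y + b)"
    by (simp add: floor_vec_def vec_eq_iff)
  then have "affine_mod1 A b x - affine_mod1 A b y = A *v (x - y)"
    by (simp add: affine_mod1_def matrix_vector_mult_diff_distrib)
  then show ?thesis using contr by simp
qed

text \<open>The points satisfying the margin inequality form a closed set \<open>E\<close>, which
  all orbits reach at time \<open>n\<close>.\<close>

lemma asymptotically_periodic_affine_mod1:
  assumes b: "b = c - A *v c" and \<eta>: "\<eta> > 0" and m: "margin c n \<eta>"
  shows "asymptotically_periodic unit_cube (affine_mod1 A b)"
proof -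
  define E where "E = {x. \<forall>j (q::int). \<eta> \<le> \<bar>(A *v x + b) $ j - of_int q\<bar>}"
  have "local_contraction (affine_mod1 A b) unit_cube E l \<eta> n"
  proof
    show "0 \<le> l" "l < 1" "0 < \<eta>" using l \<eta> by auto
    show "bounded (unit_cube :: (real^'d) set)"
      by (rule bounded_subset[OF bounded_cbox[of 0 1]]) (auto simp: unit_cube_def mem_box_cart less_imp_le)
    show "affine_mod1 A b x \<in> unit_cube" for x
      unfolding unit_cube_def affine_mod1_def floor_vec_def by (auto, linarith)
    have "E = (\<Inter>j. \<Inter>q::int. {x. \<eta> \<le> \<bar>(A *v x + b) $ j - of_int q\<bar>})"
      by (auto simp: E_def)
    moreover have "closed {x. \<eta> \<le> \<bar>(A *v x + b) $ j - of_int q\<bar>}" for j and q :: int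
      by (intro closed_Collect_le continuous_intros)
    ultimately show "closed E" by auto
    show "(affine_mod1 A b ^^ n) x \<in> E" if "x \<in> unit_cube" for x
    proof -
      have eq: "A *v (affine_mod1 A b ^^ n) x + b = A *v (g c ^^ n) (x - c) + c"
        unfolding affine_mod1_conjugate[OF b] by (simp add: b matrix_vector_right_distrib)
      show ?thesis
        using m[unfolded margin_def, rule_format, of "x - c"] that
        unfolding E_def mem_Collect_eq eq by simp
    qed
    show "infnorm (affine_mod1 A b x - affine_mod1 A b y) \<le> l * infnorm (x - y)"
      if "x \<in> E" "y \<in> E" "infnorm (x - y) < \<eta>" for x y
      using that by (intro infnorm_affine_mod1_diff_le) (auto simp: E_def)
  qed
  then show ?thesis by (rule local_contraction.asymptotically_periodic)
qed

lemma linear_id_minus: "linear (\<lambda>c. c - A *v c)"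
  by (intro linear_compose_sub matrix_vector_mul_linear) (simp add: linear_iff)

lemma surj_id_minus: "surj (\<lambda>c. c - A *v c)"
proof (rule linear_injective_imp_surjective[OF _ _ refl])
  show "linear (\<lambda>c. c - A *v c)" by (rule linear_id_minus)
  show "inj (\<lambda>c. c - A *v c)"
  proof (rule linear_injective_0[OF linear_id_minus, THEN iffD2], intro allI impI)
    fix c assume "c - A *v c = 0"
    then have "infnorm c \<le> l * infnorm c" using contr[of c] by simp
    then have "infnorm c = 0"
      using l infnorm_pos_le[of c] mult_less_cancel_right2[of l "infnorm c"] by linarith
    then show "c = 0" by (simp add: infnorm_eq_0)
  qed
qed

text \<open>Every \<open>b\<close> has the form \<open>c - A *v c\<close>, and this linear map takes
  the null set of exceptional \<open>c\<close> to a null set.\<close>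

lemma AE_asymptotically_periodic:
  "AE b in lebesgue. asymptotically_periodic unit_cube (affine_mod1 A b)"
  unfolding eventually_ae_filter_negligible
proof (intro exI conjI)
  let ?B = "{c. \<not> (\<exists>n. \<exists>\<eta>>0. margin c n \<eta>)}"
  show "negligible ((\<lambda>c. c - A *v c) ` ?B)"
    by (intro negligible_differentiable_image_negligible negligible_no_margin order_refl
        linear_imp_differentiable_on linear_id_minus)
  show "{b. \<not> asymptotically_periodic unit_cube (affine_mod1 A b)} \<subseteq> (\<lambda>c. c - A *v c) ` ?B"
  proof
    fix b assume b: "b \<in> {b. \<not> asymptotically_periodic unit_cube (affine_mod1 A b)}"
    obtain c where c: "b = c - A *v c" using surj_id_minus by blast
    then have "c \<in> ?B" using b asymptotically_periodic_affine_mod1[OF c] by blast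
    then show "b \<in> (\<lambda>c. c - A *v c) ` ?B" using c by blast
  qed
qed

end

text \<open>The real supremum bounds its members once the set is known to be bounded above;
  comparison with the Euclidean norm shows this.\<close>

lemma infnorm_le_max_onorm: "infnorm (A *v x) \<le> max_onorm A * infnorm x" for A :: "real^'d^'d"
proof (cases "x = 0")
  case True
  then show ?thesis by (simp add: infnorm_0)
next
  case False
  obtain K where K: "\<And>x. norm (A *v x) \<le> norm x * K"
    using bounded_linear.bounded[OF matrix_vector_mul_bounded_linear[of A]] by blast
  have "bdd_above ((\<lambda>x. infnorm (A *v x) / infnorm x) ` {x. x \<noteq> 0})"
  proof (rule bdd_aboveI2)
    fix x :: "real^'d" assume "x \<in> {x. x \<noteq> 0}"
    then have x: "infnorm x > 0" by (simp add: infnorm_pos_lt)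
    have "infnorm (A *v x) \<le> norm (A *v x)" by (rule infnorm_le_norm)
    also have "\<dots> \<le> norm x * \<bar>K\<bar>" using K[of x] by (meson abs_ge_self mult_left_mono norm_ge_zero order_trans)
    also have "\<dots> \<le> (sqrt DIM(real^'d) * infnorm x) * \<bar>K\<bar>"
      by (intro mult_right_mono norm_le_infnorm) auto
    finally show "infnorm (A *v x) / infnorm x \<le> sqrt DIM(real^'d) * \<bar>K\<bar>"
      using x by (simp add: divide_le_eq mult_ac)
  qed
  then have "infnorm (A *v x) / infnorm x \<le> max_onorm A"
    unfolding max_onorm_def using False by (intro cSUP_upper) auto
  then show ?thesis using False by (simp add: divide_le_eq infnorm_pos_lt)
qed

theorem theorem1:
  fixes A :: "real^'d^'d"
  assumes "invertible A"
    and "max_onorm A < 1"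
  shows "AE b in lebesgue. asymptotically_periodic unit_cube (affine_mod1 A b)"
proof -
  \<comment> \<open>The maximum with \<open>1/2\<close> supplies \<open>0 < l\<close> and keeps
    \<open>l < 1\<close>.\<close>
  define l where "l = max (1/2) (max_onorm A)"
  have "infnorm (A *v x) \<le> l * infnorm x" for x
    using infnorm_le_max_onorm[of A x] mult_right_mono[of "max_onorm A" l "infnorm x"] infnorm_pos_le[of x]
    by (simp add: l_def)
  then have "cart_contraction A l"
    using assms(2) by unfold_locales (auto simp: l_def)
  then show ?thesis by (rule cart_contraction.AE_asymptotically_periodic)
qed

end
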